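(* Let $P$ be the transition kernel of the MESSEP on $\mathcal C_{L,N}$ (see context), and let $\lambda_{L,N}$ be the second eigenvalue of maximal modulus of $P$. Then the spectral gap $1-\lambda_{L,N}$ satisfies the following asymptotics as $L\to\infty$: 1. Assume that $N/L\to0$ (low-density limit). Then there exists a positive constant $C$, independent of $L$ and $N$, such that $$\left|1-\lambda_{L,N}-\frac{2\pi^2}{L^2}\right|\le C\left(\frac NL\right)^2\frac1{L^2}.$$ 2. Assume that $N/L\to\alpha$ (hydrodynamic limit), with $\alpha$ belonging to a compact set $K\subset(0,1)$. Then there exists a positive constant $C_K$, independent of $L$, $N$ and $\alpha$, such that $$\left|1-\lambda_{L,N}-\frac{2\pi^2}{L^2}\right|\le\frac{C_K}{L^3}.$$
   Context: Let $1\le N\le L-1$ be integers. $\mathcal C_{L,N}$ is the set of $N$-element subsets of $\mathbb Z/L\mathbb Z$, made into an undirected connected graph by joining two configurations when one is obtained from the other by moving exactly one particle to a nearest-neighbour ($\pm1$ mod $L$) empty site. Let $A$ be its adjacency matrix, $\rho$ its spectral radius and $\psi>0$ a positive eigenvector, $A\psi=\rho\psi$. The MESSEP (maximal entropy simple symmetric exclusion process) on $\mathcal C_{L,N}$ is the Markov chain with kernel $P(\xi,\eta)=A(\xi,\eta)\,\psi(\eta)/(\rho\,\psi(\xi))$. Its eigenvalues are real, being those of $A$ divided by $\rho$, and its largest eigenvalue is $1$.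
   Formalization: λ_{L,N} is taken as the second largest (real) eigenvalue with multiplicity, not the second by modulus: by modulus the claim fails, since −1 is an eigenvalue for even L, and for odd L the eigenvalue −cos(π/L) exceeds cos(2π/L) in modulus. *)

theory Defs
  imports Complex_Main "Jordan_Normal_Form.Spectral_Radius"
begin

text \<open>The sites of \<open>\<int>/L\<int>\<close> are represented by their residues \<open>0, \<dots>, L - 1\<close>.\<close>

definition configs :: "nat \<Rightarrow> nat \<Rightarrow> nat set set" where
  "configs L N = {\<xi>. \<xi> \<subseteq> {0..<L} \<and> card \<xi> = N}"

definition neighbours :: "nat \<Rightarrow> nat \<Rightarrow> nat \<Rightarrow> bool" where
  "neighbours L x y \<longleftrightarrow> y = (x + 1) mod L \<or> x = (y + 1) mod L"

definition adjacent :: "nat \<Rightarrow> nat set \<Rightarrow> nat set \<Rightarrow> bool" where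
  "adjacent L \<xi> \<eta> \<longleftrightarrow>
     (\<exists>x \<in> \<xi>. \<exists>y \<in> {0..<L} - \<xi>. neighbours L x y \<and> \<eta> = insert y (\<xi> - {x}))"

definition adjacency :: "nat \<Rightarrow> nat set \<Rightarrow> nat set \<Rightarrow> real" where
  "adjacency L \<xi> \<eta> = (if adjacent L \<xi> \<eta> then 1 else 0)"

text \<open>
  A kernel on a finite set \<open>S\<close> is turned into a matrix by means of an arbitrary enumeration
  of \<open>S\<close>; the choice changes the matrix only by a simultaneous permutation of rows and columns,
  so its spectrum and characteristic polynomial do not depend on it.
\<close>

definition enumeration :: "'a set \<Rightarrow> 'a list" where
  "enumeration S = (SOME xs. set xs = S \<and> distinct xs)"

definition kernel_matrix :: "'a set \<Rightarrow> ('a \<Rightarrow> 'a \<Rightarrow> real) \<Rightarrow> real mat" where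
  "kernel_matrix S k =
     mat (card S) (card S) (\<lambda>(i, j). k (enumeration S ! i) (enumeration S ! j))"

definition rho :: "nat \<Rightarrow> nat \<Rightarrow> real" where
  "rho L N = spectral_radius (map_mat complex_of_real (kernel_matrix (configs L N) (adjacency L)))"

definition positive_eigenvector :: "nat \<Rightarrow> nat \<Rightarrow> (nat set \<Rightarrow> real) \<Rightarrow> bool" where
  "positive_eigenvector L N \<psi> \<longleftrightarrow>
     (\<forall>\<xi> \<in> configs L N. \<psi> \<xi> > 0) \<and>
     (\<forall>\<xi> \<in> configs L N. (\<Sum>\<eta> \<in> configs L N. adjacency L \<xi> \<eta> * \<psi> \<eta>) = rho L N * \<psi> \<xi>)"

definition messep_kernel ::
    "nat \<Rightarrow> nat \<Rightarrow> (nat set \<Rightarrow> real) \<Rightarrow> nat set \<Rightarrow> nat set \<Rightarrow> real" where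
  "messep_kernel L N \<psi> \<xi> \<eta> = adjacency L \<xi> \<eta> * \<psi> \<eta> / (rho L N * \<psi> \<xi>)"

text \<open>
  The real eigenvalues in nonincreasing order, each repeated according to its algebraic
  multiplicity. The eigenvalues of the kernels considered here are all real.
\<close>

definition ordered_eigenvalues :: "real mat \<Rightarrow> real list" where
  "ordered_eigenvalues M = rev (sorted_list_of_multiset (proots (char_poly M)))"

text \<open>
  The largest eigenvalue \<open>1\<close> has index 0, so the second one has index 1. The ordering is that of
  the real line and not by modulus: for even \<open>L\<close> the graph is bipartite and \<open>-1\<close> is an
  eigenvalue, while for odd \<open>L\<close> the smallest eigenvalue is \<open>- cos (\<pi> / L)\<close>.
\<close>

definition second_eigenvalue :: "nat \<Rightarrow> nat \<Rightarrow> (nat set \<Rightarrow> real) \<Rightarrow> real" where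
  "second_eigenvalue L N \<psi> =
     ordered_eigenvalues (kernel_matrix (configs L N) (messep_kernel L N \<psi>)) ! 1"

end

theory Submission
  imports Defs
begin

text \<open>
  The second eigenvalue is \<open>cos (2 * pi / L)\<close> for every admissible \<open>N\<close>. The gap is therefore
  \<open>2 * (sin (pi / L))\<^sup>2\<close>, which differs from \<open>2 * pi\<^sup>2 / L\<^sup>2\<close> by at most \<open>pi ^ 4 / L ^ 4\<close>. As \<open>N \<ge> 1\<close>,
  both error terms of the theorem are at least of this order, with the constant \<open>pi ^ 4\<close>.

  The eigenvalue is found by treating the particles as free fermions. Creation and annihilation
  operators act on functions of sets of sites with the Jordan-Wigner sign, which counts the particles to
  the left. On configurations of \<open>N\<close> particles the adjacency matrix is the second quantization of a
  one-particle hopping matrix; a jump across the bond between \<open>L - 1\<close> and \<open>0\<close> passes the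
  \<open>N - 1\<close> other particles, and the sign \<open>(-1) ^ (N - 1)\<close> is absorbed into that matrix
  (\<open>second_quantization_hop\<close>). Plane waves with the momenta \<open>(2 * k - N + 1) * pi / L\<close>, \<open>k < L\<close>,
  diagonalize the hopping matrix (\<open>hop_mode\<close>). The products of \<open>N\<close> distinct plane-wave creators,
  applied to the vacuum, are eigenfunctions of the adjacency matrix whose eigenvalues add up the
  cosines of the momenta (\<open>adjacency_fermi_state\<close>). They are orthogonal
  (\<open>fermi_state_orthogonal\<close>) and as numerous as the configurations, so they give the whole spectrum
  with multiplicities (\<open>proots_kernel_matrix\<close>, \<open>proots_messep\<close>).

  The largest energy comes from the modes \<open>0, \<dots>, N - 1\<close> and is proportional to
  \<open>sin (N * pi / L) / sin (pi / L)\<close>. Any other choice of modes replaces at least one of these by one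
  outside, which costs at least \<open>cos ((N - 1) * pi / L) - cos ((N + 1) * pi / L)\<close>, that is
  \<open>2 * sin (N * pi / L) * sin (pi / L)\<close>; promoting the mode \<open>N - 1\<close> to \<open>N\<close> costs exactly this
  (\<open>energy_le_excited\<close>, \<open>energy_excited\<close>). In the quotient the sine of \<open>N * pi / L\<close> cancels.
  The normalization \<open>rho\<close> is the largest energy because it belongs to a positive eigenvector
  (\<open>rho_eq\<close>).
\<close>

section \<open>Fermionic operators\<close>

text \<open>
  The Jordan-Wigner sign: a particle entering or leaving site \<open>x\<close> passes all particles to its left.
  The set that is counted is finite even for infinite \<open>\<xi>\<close>, so the default value of \<open>card\<close> never
  interferes with the anticommutation relations.
\<close>

definition fermion_sign :: "nat \<Rightarrow> nat set \<Rightarrow> complex" where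
  "fermion_sign x \<xi> = (-1) ^ card {y \<in> \<xi>. y < x}"

definition create :: "nat \<Rightarrow> (nat set \<Rightarrow> complex) \<Rightarrow> nat set \<Rightarrow> complex" where
  "create x f \<xi> = (if x \<in> \<xi> then fermion_sign x \<xi> * f (\<xi> - {x}) else 0)"

definition annihilate :: "nat \<Rightarrow> (nat set \<Rightarrow> complex) \<Rightarrow> nat set \<Rightarrow> complex" where
  "annihilate x f \<xi> = (if x \<in> \<xi> then 0 else fermion_sign x \<xi> * f (insert x \<xi>))"

lemma fermion_sign_square [simp]: "fermion_sign x \<xi> * fermion_sign x \<xi> = 1"
  by (simp add: fermion_sign_def flip: power_add mult_2)

lemma cnj_fermion_sign [simp]: "cnj (fermion_sign x \<xi>) = fermion_sign x \<xi>"
  by (simp add: fermion_sign_def)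

lemma fermion_sign_insert:
  "fermion_sign x (insert y \<xi>) =
     (if y < x \<and> y \<notin> \<xi> then - fermion_sign x \<xi> else fermion_sign x \<xi>)"
proof -
  have "{z \<in> insert y \<xi>. z < x} =
          (if y < x then insert y {z \<in> \<xi>. z < x} else {z \<in> \<xi>. z < x})"
    by auto
  then show ?thesis
    by (auto simp: fermion_sign_def insert_absorb)
qed

lemma fermion_sign_delete:
  "fermion_sign x (\<xi> - {y}) =
     (if y < x \<and> y \<in> \<xi> then - fermion_sign x \<xi> else fermion_sign x \<xi>)"
  using fermion_sign_insert[of x y "\<xi> - {y}"] by (cases "y \<in> \<xi>") (auto simp: insert_absorb)

text \<open>
  Of the two sites, exactly the larger one sees the particle on the smaller one, so reversing the
  order of the two operations changes exactly one of the two signs.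
\<close>

lemma create_create: "create x (create y f) \<xi> = - create y (create x f) \<xi>"
proof -
  have "\<xi> - {x} - {y} = \<xi> - {y} - {x}" by auto
  then show ?thesis
    by (cases x y rule: linorder_cases) (auto simp: create_def fermion_sign_delete)
qed

lemma annihilate_create:
  "annihilate x (create y f) \<xi> = (if x = y then f \<xi> else 0) - create y (annihilate x f) \<xi>"
proof (cases "x = y")
  case True
  then show ?thesis
    by (auto simp: create_def annihilate_def fermion_sign_insert fermion_sign_delete insert_absorb)
next
  case False
  then have "insert x \<xi> - {y} = insert x (\<xi> - {y})" by auto
  with False show ?thesis
    by (cases x y rule: linorder_cases)
       (auto simp: create_def annihilate_def fermion_sign_insert fermion_sign_delete)
qed

text \<open>
  \<open>smeared_create L \<phi>\<close> adds a particle with one-particle wave function \<open>\<phi>\<close>; the conjugate in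
  \<open>smeared_annihilate\<close> makes the two operators adjoint to each other.
\<close>

definition smeared_create ::
    "nat \<Rightarrow> (nat \<Rightarrow> complex) \<Rightarrow> (nat set \<Rightarrow> complex) \<Rightarrow> nat set \<Rightarrow> complex" where
  "smeared_create L \<phi> f \<xi> = (\<Sum>x<L. \<phi> x * create x f \<xi>)"

definition smeared_annihilate ::
    "nat \<Rightarrow> (nat \<Rightarrow> complex) \<Rightarrow> (nat set \<Rightarrow> complex) \<Rightarrow> nat set \<Rightarrow> complex" where
  "smeared_annihilate L \<phi> f \<xi> = (\<Sum>x<L. cnj (\<phi> x) * annihilate x f \<xi>)"

lemma create_smeared_create:
  "create x (smeared_create L \<phi> f) \<xi> = (\<Sum>y<L. \<phi> y * create x (create y f) \<xi>)"
  by (simp add: create_def[of x] smeared_create_def sum_distrib_left mult_ac)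

lemma annihilate_smeared_create:
  "annihilate x (smeared_create L \<phi> f) \<xi> = (\<Sum>y<L. \<phi> y * annihilate x (create y f) \<xi>)"
  by (simp add: annihilate_def[of x] smeared_create_def sum_distrib_left mult_ac)

lemma create_smeared_annihilate:
  "create x (smeared_annihilate L \<phi> f) \<xi> = (\<Sum>y<L. cnj (\<phi> y) * create x (annihilate y f) \<xi>)"
  by (simp add: create_def[of x] smeared_annihilate_def sum_distrib_left mult_ac)

lemma create_0 [simp]: "create x (\<lambda>_. 0) = (\<lambda>_. 0)"
  by (auto simp: create_def)

lemma smeared_create_0 [simp]: "smeared_create L \<phi> (\<lambda>_. 0) = (\<lambda>_. 0)"
  by (auto simp: smeared_create_def)

lemma create_smeared_create_anticommute:
  "create x (smeared_create L \<phi> f) \<xi> = - smeared_create L \<phi> (create x f) \<xi>"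
  unfolding create_smeared_create smeared_create_def sum_negf[symmetric]
  by (intro sum.cong refl) (simp add: create_create[of x])

lemma smeared_create_anticommute:
  "smeared_create L \<phi> (smeared_create L \<chi> f) \<xi> = - smeared_create L \<chi> (smeared_create L \<phi> f) \<xi>"
proof -
  have "smeared_create L \<phi> (smeared_create L \<chi> f) \<xi> =
          (\<Sum>x<L. \<Sum>y<L. \<phi> x * (\<chi> y * create x (create y f) \<xi>))"
    by (simp add: smeared_create_def[of L \<phi>] create_smeared_create sum_distrib_left)
  also have "\<dots> = (\<Sum>y<L. \<Sum>x<L. \<phi> x * (\<chi> y * create x (create y f) \<xi>))"
    by (rule sum.swap)
  also have "\<dots> = (\<Sum>y<L. \<Sum>x<L. - (\<chi> y * (\<phi> x * create y (create x f) \<xi>)))"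
    by (intro sum.cong refl) (subst create_create, simp add: mult_ac)
  also have "\<dots> = - smeared_create L \<chi> (smeared_create L \<phi> f) \<xi>"
    by (simp add: smeared_create_def[of L \<chi>] create_smeared_create sum_distrib_left sum_negf)
  finally show ?thesis .
qed

lemma annihilate_smeared_create_anticommute:
  assumes "x < L"
  shows "annihilate x (smeared_create L \<phi> f) \<xi> = \<phi> x * f \<xi> - smeared_create L \<phi> (annihilate x f) \<xi>"
proof -
  have "annihilate x (smeared_create L \<phi> f) \<xi> =
          (\<Sum>y<L. (if y = x then \<phi> y * f \<xi> else 0) - \<phi> y * create y (annihilate x f) \<xi>)"
    unfolding annihilate_smeared_create
    by (intro sum.cong refl) (auto simp: annihilate_create algebra_simps)
  then show ?thesis
    using assms by (simp add: smeared_create_def sum_subtractf)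
qed

text \<open>
  The canonical anticommutation relation: the defect is the inner product of the two wave functions,
  so operators that belong to orthogonal wave functions anticommute.
\<close>

lemma smeared_annihilate_smeared_create:
  "smeared_annihilate L \<phi> (smeared_create L \<chi> f) \<xi> =
     (\<Sum>x<L. cnj (\<phi> x) * \<chi> x) * f \<xi> - smeared_create L \<chi> (smeared_annihilate L \<phi> f) \<xi>"
proof -
  have "smeared_create L \<chi> (smeared_annihilate L \<phi> f) \<xi> =
          (\<Sum>y<L. \<Sum>x<L. cnj (\<phi> x) * (\<chi> y * create y (annihilate x f) \<xi>))"
    by (simp add: smeared_create_def create_smeared_annihilate sum_distrib_left mult_ac)
  also have "\<dots> = (\<Sum>x<L. \<Sum>y<L. cnj (\<phi> x) * (\<chi> y * create y (annihilate x f) \<xi>))"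
    by (rule sum.swap)
  finally show ?thesis
    by (simp add: smeared_annihilate_def annihilate_smeared_create_anticommute algebra_simps
        sum_subtractf sum_distrib_left) (simp add: smeared_create_def sum_distrib_left mult_ac)
qed

definition inner_prod :: "nat \<Rightarrow> (nat set \<Rightarrow> complex) \<Rightarrow> (nat set \<Rightarrow> complex) \<Rightarrow> complex" where
  "inner_prod L f g = (\<Sum>\<xi>\<in>Pow {..<L}. cnj (f \<xi>) * g \<xi>)"

text \<open>
  Inserting \<open>x\<close> is a bijection from the sets without \<open>x\<close> to those with \<open>x\<close>, and it leaves the
  sites to the left of \<open>x\<close> alone, hence preserves the sign at \<open>x\<close>.
\<close>

lemma inner_prod_create:
  assumes "x < L"
  shows "inner_prod L (create x f) g = inner_prod L f (annihilate x g)"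
proof -
  have "inner_prod L (create x f) g =
          (\<Sum>\<xi>\<in>{\<xi> \<in> Pow {..<L}. x \<in> \<xi>}. cnj (create x f \<xi>) * g \<xi>)"
    unfolding inner_prod_def by (intro sum.mono_neutral_right) (auto simp: create_def)
  also have "\<dots> = (\<Sum>\<xi>\<in>{\<xi> \<in> Pow {..<L}. x \<notin> \<xi>}. cnj (f \<xi>) * annihilate x g \<xi>)"
    by (rule sum.reindex_bij_witness[of _ "insert x" "\<lambda>\<xi>. \<xi> - {x}"])
       (use assms in \<open>auto simp: create_def annihilate_def insert_absorb fermion_sign_delete\<close>)
  also have "\<dots> = inner_prod L f (annihilate x g)"
    unfolding inner_prod_def by (intro sum.mono_neutral_left) (auto simp: annihilate_def)
  finally show ?thesis .
qed

lemma inner_prod_sum_left: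
  "inner_prod L (\<lambda>\<xi>. \<Sum>x\<in>A. c x * F x \<xi>) g = (\<Sum>x\<in>A. cnj (c x) * inner_prod L (F x) g)"
  by (simp add: inner_prod_def sum_distrib_left sum_distrib_right mult_ac) (rule sum.swap)

lemma inner_prod_sum_right:
  "inner_prod L f (\<lambda>\<xi>. \<Sum>x\<in>A. c x * G x \<xi>) = (\<Sum>x\<in>A. c x * inner_prod L f (G x))"
  by (simp add: inner_prod_def sum_distrib_left mult_ac) (rule sum.swap)

lemma inner_prod_smeared_create:
  "inner_prod L (smeared_create L \<phi> f) g = inner_prod L f (smeared_annihilate L \<phi> g)"
proof -
  have "inner_prod L (smeared_create L \<phi> f) g = (\<Sum>x<L. cnj (\<phi> x) * inner_prod L (create x f) g)"
    unfolding smeared_create_def[abs_def] by (rule inner_prod_sum_left)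
  also have "\<dots> = (\<Sum>x<L. cnj (\<phi> x) * inner_prod L f (annihilate x g))"
    by (simp add: inner_prod_create)
  also have "\<dots> = inner_prod L f (smeared_annihilate L \<phi> g)"
    unfolding smeared_annihilate_def[abs_def] by (rule inner_prod_sum_right[symmetric])
  finally show ?thesis .
qed

lemma inner_prod_0_left [simp]: "inner_prod L (\<lambda>_. 0) g = 0"
  by (simp add: inner_prod_def)

section \<open>Slater states\<close>

definition vacuum :: "nat set \<Rightarrow> complex" where
  "vacuum \<xi> = (if \<xi> = {} then 1 else 0)"

text \<open>
  Its value at \<open>\<xi>\<close> is, up to sign, the Slater determinant of the wave functions \<open>\<phi> k\<close> at the
  sites of \<open>\<xi>\<close>. Building it from creation operators replaces the theory of determinants by the
  anticommutation relations.
\<close>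

definition slater :: "nat \<Rightarrow> ('k \<Rightarrow> nat \<Rightarrow> complex) \<Rightarrow> 'k list \<Rightarrow> nat set \<Rightarrow> complex" where
  "slater L \<phi> ks = foldr (\<lambda>k. smeared_create L (\<phi> k)) ks vacuum"

lemma slater_Nil [simp]: "slater L \<phi> [] = vacuum"
  and slater_Cons [simp]: "slater L \<phi> (k # ks) = smeared_create L (\<phi> k) (slater L \<phi> ks)"
  by (simp_all add: slater_def)

lemma slater_support:
  assumes "slater L \<phi> ks \<xi> \<noteq> 0"
  shows "\<xi> \<in> configs L (length ks)"
  using assms
proof (induction ks arbitrary: \<xi>)
  case Nil
  then show ?case by (auto simp: vacuum_def configs_def split: if_splits)
next
  case (Cons k ks)
  then obtain x where x: "x < L" "\<phi> k x * create x (slater L \<phi> ks) \<xi> \<noteq> 0"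
    by (auto simp: smeared_create_def elim: sum.not_neutral_contains_not_neutral)
  then have "x \<in> \<xi>" "\<xi> - {x} \<in> configs L (length ks)"
    using Cons.IH[of "\<xi> - {x}"] by (auto simp: create_def split: if_splits)
  moreover have "finite \<xi>"
    using calculation(2) unfolding configs_def by (metis (no_types, lifting) finite_Diff2 finite.emptyI
        finite_insert finite_atLeastLessThan finite_subset mem_Collect_eq)
  ultimately show ?case
    using x(1) card_Suc_Diff1[of \<xi> x] by (auto simp: configs_def)
qed

text \<open>
  Pauli exclusion: the new operator can be moved, up to sign, next to the factor of the same mode,
  and the square of an operator that anticommutes with itself vanishes.
\<close>

lemma smeared_create_slater_eq_0:
  assumes "k \<in> set ks"
  shows "smeared_create L (\<phi> k) (slater L \<phi> ks) = (\<lambda>_. 0)"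
  using assms
proof (induction ks)
  case (Cons a ks)
  have anti: "smeared_create L (\<phi> k) (smeared_create L (\<phi> a) (slater L \<phi> ks)) \<xi> =
          - smeared_create L (\<phi> a) (smeared_create L (\<phi> k) (slater L \<phi> ks)) \<xi>" for \<xi>
    by (rule smeared_create_anticommute)
  show ?case
  proof (cases "a = k")
    case True
    then show ?thesis using anti by (auto simp: fun_eq_iff)
  next
    case False
    then have "smeared_create L (\<phi> k) (slater L \<phi> ks) = (\<lambda>_. 0)" using Cons by simp
    then show ?thesis using anti by (intro ext) simp
  qed
qed simp

locale orthogonal_modes =
  fixes L :: nat and \<phi> :: "'k \<Rightarrow> nat \<Rightarrow> complex" and M :: "'k set" and c :: complex
  assumes orthogonal:
    "k \<in> M \<Longrightarrow> l \<in> M \<Longrightarrow> (\<Sum>x<L. cnj (\<phi> k x) * \<phi> l x) = (if k = l then c else 0)"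
  and norm_nonzero: "c \<noteq> 0"
begin

text \<open>
  An absent mode is orthogonal to all the factors, so its annihilator passes, up to sign, through them
  to the vacuum, which it kills.
\<close>

lemma smeared_annihilate_slater_eq_0:
  assumes "k \<in> M" "set ks \<subseteq> M" "k \<notin> set ks"
  shows "smeared_annihilate L (\<phi> k) (slater L \<phi> ks) = (\<lambda>_. 0)"
  using assms(2,3)
proof (induction ks)
  case Nil
  then show ?case by (auto simp: smeared_annihilate_def annihilate_def vacuum_def)
next
  case (Cons a ks)
  then have "smeared_annihilate L (\<phi> k) (slater L \<phi> ks) = (\<lambda>_. 0)" by simp
  then show ?case
    using Cons.prems assms(1) orthogonal[of k a]
    by (intro ext) (auto simp: smeared_annihilate_smeared_create)
qed

lemma inner_prod_slater_self:
  assumes "set ks \<subseteq> M" "distinct ks"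
  shows "inner_prod L (slater L \<phi> ks) (slater L \<phi> ks) = c ^ length ks"
  using assms
proof (induction ks)
  case Nil
  have "inner_prod L vacuum vacuum = (\<Sum>\<xi>\<in>{{} :: nat set}. 1)"
    unfolding inner_prod_def
    by (rule sum.mono_neutral_cong_right) (auto simp: vacuum_def split: if_splits)
  then show ?case by simp
next
  case (Cons k ks)
  have "smeared_annihilate L (\<phi> k) (slater L \<phi> (k # ks)) = (\<lambda>\<xi>. c * slater L \<phi> ks \<xi>)"
    using Cons.prems orthogonal[of k k]
    by (simp add: fun_eq_iff smeared_annihilate_smeared_create smeared_annihilate_slater_eq_0)
  then have "inner_prod L (slater L \<phi> (k # ks)) (slater L \<phi> (k # ks)) =
               inner_prod L (slater L \<phi> ks) (\<lambda>\<xi>. c * slater L \<phi> ks \<xi>)"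
    by (simp add: inner_prod_smeared_create)
  also have "\<dots> = c * c ^ length ks"
    using Cons by (simp add: inner_prod_def mult.left_commute flip: sum_distrib_left)
  finally show ?case by simp
qed

text \<open>
  With \<open>a\<close> and \<open>a'\<close> the annihilator and the creator of the mode \<open>k\<close>, the anticommutation
  relation says \<open>a a' + a' a = c\<close>. Applied to the second state, \<open>a\<close> gives zero as \<open>k\<close> is absent; in
  the other term \<open>a\<close> moves to the first state as \<open>a'\<close>, where \<open>k\<close> is present already.
\<close>

lemma inner_prod_slater_distinct:
  assumes "set ks \<subseteq> M" "set ls \<subseteq> M" "k \<in> set ks" "k \<notin> set ls"
  shows "inner_prod L (slater L \<phi> ks) (slater L \<phi> ls) = 0"
proof -
  let ?f = "slater L \<phi> ks" and ?g = "slater L \<phi> ls"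
  have k: "k \<in> M" using assms by auto
  have "smeared_create L (\<phi> k) (smeared_annihilate L (\<phi> k) ?g) = (\<lambda>_. 0)"
    using k assms by (simp add: smeared_annihilate_slater_eq_0)
  then have "(\<lambda>\<xi>. c * ?g \<xi>) = smeared_annihilate L (\<phi> k) (smeared_create L (\<phi> k) ?g)"
    using orthogonal[OF k k] by (simp add: fun_eq_iff smeared_annihilate_smeared_create)
  moreover have "inner_prod L ?f (smeared_annihilate L (\<phi> k) (smeared_create L (\<phi> k) ?g)) = 0"
    using assms(3) by (simp add: smeared_create_slater_eq_0 flip: inner_prod_smeared_create)
  ultimately have "inner_prod L ?f (\<lambda>\<xi>. c * ?g \<xi>) = 0" by simp
  then have "c * inner_prod L ?f ?g = 0"
    by (simp add: inner_prod_def mult.left_commute flip: sum_distrib_left)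
  then show ?thesis using norm_nonzero by simp
qed

end

text \<open>
  The many-particle operator in which each particle moves independently according to the
  one-particle matrix \<open>h\<close>.
\<close>

definition second_quantization ::
    "nat \<Rightarrow> (nat \<Rightarrow> nat \<Rightarrow> complex) \<Rightarrow> (nat set \<Rightarrow> complex) \<Rightarrow> nat set \<Rightarrow> complex" where
  "second_quantization L h f \<xi> = (\<Sum>y<L. \<Sum>x<L. h y x * create y (annihilate x f) \<xi>)"

text \<open>
  A quadratic operator has the commutator \<open>[H, a'(\<phi>)] = a'(h \<phi>)\<close> with a creator: in moving the
  creator past \<open>create y (annihilate x f)\<close> the two signs cancel, and the defect is
  \<open>\<phi> x * create y f\<close>. So each eigenfunction of \<open>h\<close> that is created adds its eigenvalue.
\<close>

lemma second_quantization_smeared_create: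
  assumes "\<And>y. y < L \<Longrightarrow> (\<Sum>x<L. h y x * \<phi> x) = e * \<phi> y"
  shows "second_quantization L h (smeared_create L \<phi> f) \<xi> =
           e * smeared_create L \<phi> f \<xi> + smeared_create L \<phi> (second_quantization L h f) \<xi>"
proof -
  have commute: "create y (annihilate x (smeared_create L \<phi> f)) \<xi> =
          \<phi> x * create y f \<xi> + smeared_create L \<phi> (create y (annihilate x f)) \<xi>"
    if "x < L" for x y
  proof -
    have "create y (annihilate x (smeared_create L \<phi> f)) \<xi> =
            \<phi> x * create y f \<xi> - create y (smeared_create L \<phi> (annihilate x f)) \<xi>"
      using that
      by (simp add: create_def[of y] annihilate_smeared_create_anticommute algebra_simps)
    then show ?thesis
      by (simp add: create_smeared_create_anticommute)
  qed
  have "second_quantization L h (smeared_create L \<phi> f) \<xi> =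
          (\<Sum>y<L. \<Sum>x<L. h y x * \<phi> x * create y f \<xi>) +
          (\<Sum>y<L. \<Sum>x<L. h y x * smeared_create L \<phi> (create y (annihilate x f)) \<xi>)"
    by (simp add: second_quantization_def commute algebra_simps sum.distrib)
  also have "(\<Sum>y<L. \<Sum>x<L. h y x * \<phi> x * create y f \<xi>) = e * smeared_create L \<phi> f \<xi>"
    by (simp add: smeared_create_def sum_distrib_left assms flip: sum_distrib_right)
       (simp add: mult.assoc)
  also have "(\<Sum>y<L. \<Sum>x<L. h y x * smeared_create L \<phi> (create y (annihilate x f)) \<xi>) =
               smeared_create L \<phi> (second_quantization L h f) \<xi>"
  proof -
    have "create z (second_quantization L h f) \<xi> =
            (\<Sum>y<L. \<Sum>x<L. h y x * create z (create y (annihilate x f)) \<xi>)" for z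
      by (simp add: create_def[of z] second_quantization_def sum_distrib_left mult_ac)
    then have "smeared_create L \<phi> (second_quantization L h f) \<xi> =
        (\<Sum>z<L. \<Sum>y<L. \<Sum>x<L. h y x * (\<phi> z * create z (create y (annihilate x f)) \<xi>))"
      by (simp add: smeared_create_def sum_distrib_left mult_ac)
    also have "\<dots> = (\<Sum>y<L. \<Sum>x<L. \<Sum>z<L. h y x * (\<phi> z * create z (create y (annihilate x f)) \<xi>))"
      by (subst sum.swap) (rule sum.cong[OF refl], rule sum.swap)
    finally show ?thesis
      by (simp add: smeared_create_def sum_distrib_left)
  qed
  finally show ?thesis .
qed

lemma second_quantization_slater:
  assumes "\<And>k y. k \<in> set ks \<Longrightarrow> y < L \<Longrightarrow> (\<Sum>x<L. h y x * \<phi> k x) = e k * \<phi> k y"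
  shows "second_quantization L h (slater L \<phi> ks) \<xi> = (\<Sum>k\<leftarrow>ks. e k) * slater L \<phi> ks \<xi>"
  using assms
proof (induction ks arbitrary: \<xi>)
  case Nil
  have "annihilate x vacuum = (\<lambda>_. 0)" for x
    by (auto simp: annihilate_def vacuum_def)
  then show ?case by (simp add: second_quantization_def)
next
  case (Cons k ks)
  have "second_quantization L h (slater L \<phi> ks) = (\<lambda>\<xi>. (\<Sum>k\<leftarrow>ks. e k) * slater L \<phi> ks \<xi>)"
    using Cons by (simp add: fun_eq_iff)
  moreover have "smeared_create L (\<phi> k) (\<lambda>\<xi>. a * f \<xi>) \<xi> = a * smeared_create L (\<phi> k) f \<xi>" for a f
    by (simp add: smeared_create_def create_def sum_distrib_left mult_ac if_distrib cong: if_cong)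
  ultimately show ?case
    using second_quantization_smeared_create[of L h "\<phi> k" "e k" "slater L \<phi> ks" \<xi>] Cons.prems
    by (simp add: algebra_simps)
qed

section \<open>Spectra of kernels\<close>

lemma set_enumeration: "finite S \<Longrightarrow> set (enumeration S) = S"
  and distinct_enumeration: "finite S \<Longrightarrow> distinct (enumeration S)"
  using someI_ex[OF finite_distinct_list[of S]] by (auto simp: enumeration_def)

lemma length_enumeration: "finite S \<Longrightarrow> length (enumeration S) = card S"
  using distinct_card[of "enumeration S"] by (simp add: set_enumeration distinct_enumeration)

lemma enumeration_mem: "finite S \<Longrightarrow> i < card S \<Longrightarrow> enumeration S ! i \<in> S"
  using nth_mem[of i "enumeration S"] by (simp add: set_enumeration length_enumeration)

lemma sum_enumeration:
  assumes "finite S"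
  shows "(\<Sum>i = 0..<card S. f (enumeration S ! i)) = sum f S"
proof -
  have "bij_betw ((!) (enumeration S)) {0..<card S} S"
    using assms bij_betw_nth[of "enumeration S"]
    by (simp add: set_enumeration distinct_enumeration length_enumeration atLeast0LessThan)
  then show ?thesis by (rule sum.reindex_bij_betw)
qed

text \<open>
  A biorthogonal family of as many eigenfunctions as there are points gives two square matrices that
  are inverse to each other on one side, hence on both, and so a similarity to a diagonal matrix. This
  yields the eigenvalues with their algebraic multiplicities. The eigenfunctions may be complex; the
  characteristic polynomial is compared over the complex numbers and carried back to the reals.
\<close>

lemma proots_kernel_matrix:
  fixes k :: "'a \<Rightarrow> 'a \<Rightarrow> real" and v w :: "'i \<Rightarrow> 'a \<Rightarrow> complex"
  assumes S: "finite S" and I: "finite I" and card: "card I = card S"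
    and eigen: "\<And>i x. i \<in> I \<Longrightarrow> x \<in> S \<Longrightarrow>
      (\<Sum>y\<in>S. of_real (k x y) * v i y) = of_real (e i) * v i x"
    and biorthogonal: "\<And>i j. i \<in> I \<Longrightarrow> j \<in> I \<Longrightarrow>
      (\<Sum>x\<in>S. w i x * v j x) = (if i = j then 1 else 0)"
  shows "proots (char_poly (kernel_matrix S k)) = image_mset e (mset_set I)"
proof -
  define n where "n = card S"
  define s where "s i = enumeration S ! i" for i
  define t where "t i = enumeration I ! i" for i
  have s: "s i \<in> S" if "i < n" for i
    using that S by (simp add: s_def n_def enumeration_mem)
  have t: "t i \<in> I" if "i < n" for i
    using that I by (simp add: t_def n_def enumeration_mem flip: card)
  have t_eq: "t i = t j \<longleftrightarrow> i = j" if "i < n" "j < n" for i j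
    using that I card
    by (simp add: t_def n_def nth_eq_iff_index_eq distinct_enumeration length_enumeration)
  have sum_s: "(\<Sum>i = 0..<n. f (s i)) = sum f S" for f :: "'a \<Rightarrow> complex"
    unfolding n_def s_def by (rule sum_enumeration[OF S])
  define M where "M = kernel_matrix S k"
  define A where "A = map_mat complex_of_real M"
  define V where "V = mat n n (\<lambda>(i, j). v (t j) (s i))"
  define W where "W = mat n n (\<lambda>(i, j). w (t i) (s j))"
  define D where "D = mat n n (\<lambda>(i, j). if i = j then complex_of_real (e (t i)) else 0)"
  have carrier [simp]: "M \<in> carrier_mat n n" "A \<in> carrier_mat n n" "V \<in> carrier_mat n n"
    "W \<in> carrier_mat n n" "D \<in> carrier_mat n n"
    by (simp_all add: M_def A_def V_def W_def D_def kernel_matrix_def n_def)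
  have "W * V = 1\<^sub>m n"
  proof (rule eq_matI)
    fix i j assume "i < dim_row (1\<^sub>m n :: complex mat)" "j < dim_col (1\<^sub>m n :: complex mat)"
    then have "(W * V) $$ (i, j) = (\<Sum>x = 0..<n. w (t i) (s x) * v (t j) (s x))"
      by (simp add: W_def V_def scalar_prod_def)
    also have "\<dots> = (\<Sum>x\<in>S. w (t i) x * v (t j) x)" by (rule sum_s)
    finally show "(W * V) $$ (i, j) = 1\<^sub>m n $$ (i, j)"
      using \<open>i < _\<close> \<open>j < _\<close> by (simp add: biorthogonal t t_eq)
  qed (simp_all add: W_def V_def)
  then have "V * W = 1\<^sub>m n"
    by (rule mat_mult_left_right_inverse[rotated 2]) simp_all
  have "A * V = V * D"
  proof (rule eq_matI)
    fix i j assume "i < dim_row (V * D)" "j < dim_col (V * D)"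
    then have ij: "i < n" "j < n" by (simp_all add: V_def D_def)
    then have "(A * V) $$ (i, j) = (\<Sum>x = 0..<n. of_real (k (s i) (s x)) * v (t j) (s x))"
      by (simp add: A_def M_def V_def kernel_matrix_def scalar_prod_def n_def s_def)
    also have "\<dots> = (\<Sum>x\<in>S. of_real (k (s i) x) * v (t j) x)" by (rule sum_s)
    also have "\<dots> = (\<Sum>l = 0..<n. if l = j then v (t l) (s i) * of_real (e (t l)) else 0)"
      using ij by (simp add: eigen s t)
    also have "\<dots> = (V * D) $$ (i, j)"
      using ij by (simp add: V_def D_def scalar_prod_def if_distrib cong: if_cong)
    finally show "(A * V) $$ (i, j) = (V * D) $$ (i, j)" .
  qed (simp_all add: A_def M_def V_def D_def kernel_matrix_def n_def)
  have "A = A * (V * W)"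
    using \<open>V * W = _\<close> by (simp add: right_mult_one_mat[of A n n])
  also have "\<dots> = A * V * W"
    by (rule assoc_mult_mat[symmetric, of _ n n _ n _ n]) simp_all
  also have "\<dots> = V * D * W"
    by (simp only: \<open>A * V = _\<close>)
  finally have A_eq: "A = V * D * W" .
  have "similar_mat_wit A D V W"
    by (rule similar_mat_witI[OF \<open>V * W = _\<close> \<open>W * V = _\<close> A_eq]) simp_all
  then have "char_poly A = char_poly D"
    by (intro char_poly_similar) (auto simp: similar_mat_def)
  also have "\<dots> = (\<Prod>a\<leftarrow>diag_mat D. [:- a, 1:])"
    by (rule char_poly_upper_triangular[of _ n]) (auto simp: upper_triangular_def D_def)
  also have "diag_mat D = map (\<lambda>i. of_real (e (t i))) [0..<n]"
    by (auto simp: diag_mat_def D_def)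
  also have "(\<Prod>a\<leftarrow>map (\<lambda>i. complex_of_real (e (t i))) [0..<n]. [:- a, 1:]) =
               map_poly of_real (\<Prod>i\<leftarrow>[0..<n]. [:- e (t i), 1:])"
  proof -
    interpret map_poly_inj_idom_hom complex_of_real ..
    show ?thesis by (simp add: hom_prod_list o_def)
  qed
  finally have "map_poly complex_of_real (char_poly M) =
                  map_poly of_real (\<Prod>i\<leftarrow>[0..<n]. [:- e (t i), 1:])"
    by (simp add: A_def of_real_hom.char_poly_hom[of M n])
  then have "char_poly M = (\<Prod>i\<leftarrow>[0..<n]. [:- e (t i), 1:])"
    by (simp add: poly_eq_iff coeff_map_poly)
  also have "proots \<dots> = (\<Sum>p\<leftarrow>map (\<lambda>i. [:- e (t i), 1:]) [0..<n]. proots p)"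
    by (subst proots_prod_list[symmetric]) auto
  also have "\<dots> = mset (map (\<lambda>i. e (t i)) [0..<n])"
    by (induction n) simp_all
  also have "map (\<lambda>i. e (t i)) [0..<n] = map e (enumeration I)"
    unfolding t_def n_def using I card by (intro nth_equalityI) (simp_all add: length_enumeration)
  also have "mset (enumeration I) = mset_set I"
    using mset_set_set[OF distinct_enumeration[OF I]] set_enumeration[OF I] by simp
  then have "mset (map e (enumeration I)) = image_mset e (mset_set I)"
    by simp
  finally show ?thesis by (simp add: M_def)
qed

lemma eigenvalue_mem_proots_kernel_matrix:
  fixes k :: "'a \<Rightarrow> 'a \<Rightarrow> real"
  assumes S: "finite S" and "a \<in> S" "f a \<noteq> 0"
    and eigen: "\<And>x. x \<in> S \<Longrightarrow> (\<Sum>y\<in>S. k x y * f y) = r * f x"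
  shows "r \<in># proots (char_poly (kernel_matrix S k))"
proof -
  let ?M = "kernel_matrix S k"
  define n where "n = card S"
  define s where "s i = enumeration S ! i" for i
  have s: "s i \<in> S" if "i < n" for i
    using that S by (simp add: s_def n_def enumeration_mem)
  have M: "?M \<in> carrier_mat n n"
    by (simp add: kernel_matrix_def n_def)
  define v where "v = vec n (\<lambda>i. f (s i))"
  have "?M *\<^sub>v v = r \<cdot>\<^sub>v v"
  proof (rule eq_vecI)
    fix i assume "i < dim_vec (r \<cdot>\<^sub>v v)"
    then have i: "i < n" by (simp add: v_def)
    then have "(?M *\<^sub>v v) $ i = (\<Sum>j = 0..<n. k (s i) (s j) * f (s j))"
      by (simp add: v_def kernel_matrix_def scalar_prod_def n_def s_def)
    also have "\<dots> = (\<Sum>y\<in>S. k (s i) y * f y)"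
      unfolding n_def s_def by (rule sum_enumeration[OF S])
    finally show "(?M *\<^sub>v v) $ i = (r \<cdot>\<^sub>v v) $ i"
      using i by (simp add: eigen s v_def)
  qed (simp add: v_def kernel_matrix_def n_def)
  moreover have "v \<noteq> 0\<^sub>v n"
  proof -
    obtain i where "i < n" "s i = a"
      using \<open>a \<in> S\<close> S by (metis in_set_conv_nth length_enumeration n_def s_def set_enumeration)
    then have "v $ i \<noteq> 0\<^sub>v n $ i" using \<open>f a \<noteq> 0\<close> by (simp add: v_def)
    then show ?thesis by auto
  qed
  ultimately have "eigenvalue ?M r"
    using M unfolding eigenvalue_def eigenvector_def by (intro exI[of _ v]) (auto simp: v_def)
  then have "poly (char_poly ?M) r = 0"
    using eigenvalue_root_char_poly[OF M] by simp
  moreover have "char_poly ?M \<noteq> 0"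
    using degree_monic_char_poly[OF M] by auto
  ultimately show ?thesis by simp
qed

lemma second_largest_of_multiset:
  fixes a b :: "'a :: linorder"
  assumes "b \<le> a" "\<And>x. x \<in># X \<Longrightarrow> x \<le> b"
  shows "rev (sorted_list_of_multiset (add_mset a (add_mset b X))) ! 1 = b"
proof -
  let ?xs = "sorted_list_of_multiset X @ [b, a]"
  have "sorted ?xs"
    using assms by (auto simp: sorted_append intro: order_trans)
  then have "sort ?xs = ?xs" by (rule sorted_sort_id)
  moreover have "sort ?xs = sorted_list_of_multiset (mset ?xs)"
    by (rule sorted_list_of_multiset_mset[symmetric])
  moreover have "mset ?xs = add_mset a (add_mset b X)" by simp
  ultimately have "sorted_list_of_multiset (add_mset a (add_mset b X)) = ?xs" by metis
  then show ?thesis by simp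
qed

section \<open>The hopping operator on the ring\<close>

lemma finite_configs [simp]: "finite (configs L N)"
  unfolding configs_def by (rule finite_subset[of _ "Pow {0..<L}"]) auto

lemma neighbours_iff:
  assumes "x < L" "y < L" "2 \<le> L"
  shows "neighbours L x y \<longleftrightarrow>
           x = Suc y \<or> y = Suc x \<or> (x = 0 \<and> y = L - 1) \<or> (x = L - 1 \<and> y = 0)"
proof -
  have "(z + 1) mod L = (if z = L - 1 then 0 else Suc z)" if "z < L" for z
    using that by (cases "Suc z = L") auto
  then show ?thesis
    using assms by (auto simp: neighbours_def)
qed

text \<open>
  Crossing the bond between \<open>L - 1\<close> and \<open>0\<close> means passing all \<open>N - 1\<close> other particles. The factor
  \<open>(-1) ^ (N - 1)\<close> on that bond compensates the resulting Jordan-Wigner sign. For \<open>L = 2\<close> the two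
  bonds coincide, but there is only one particle and the factor is \<open>1\<close>.
\<close>

definition hop :: "nat \<Rightarrow> nat \<Rightarrow> nat \<Rightarrow> nat \<Rightarrow> complex" where
  "hop L N y x =
     (if x = Suc y \<or> y = Suc x then 1 else if neighbours L x y then (-1) ^ (N - 1) else 0)"

lemma fermion_sign_0 [simp]: "fermion_sign 0 \<xi> = 1"
  by (simp add: fermion_sign_def)

lemma fermion_sign_Suc:
  "fermion_sign (Suc x) \<xi> = (if x \<in> \<xi> then - fermion_sign x \<xi> else fermion_sign x \<xi>)"
proof -
  have "{y \<in> \<xi>. y < Suc x} = (if x \<in> \<xi> then insert x {y \<in> \<xi>. y < x} else {y \<in> \<xi>. y < x})"
    by (auto simp: less_Suc_eq)
  then show ?thesis by (simp add: fermion_sign_def)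
qed

lemma fermion_sign_last:
  assumes "\<xi> \<subseteq> {0..<L}"
  shows "fermion_sign (L - 1) \<xi> = (-1) ^ card (\<xi> - {L - 1})"
proof -
  have "{y \<in> \<xi>. y < L - 1} = \<xi> - {L - 1}"
    using assms by force
  then show ?thesis by (simp add: fermion_sign_def)
qed

lemma hop_create_annihilate:
  assumes \<xi>: "\<xi> \<in> configs L N" and "x < L" "y < L" "2 \<le> L"
  shows "hop L N y x * create y (annihilate x f) \<xi> =
           (if y \<in> \<xi> \<and> x \<notin> \<xi> \<and> neighbours L y x then f (insert x (\<xi> - {y})) else 0)"
proof (cases "y \<in> \<xi> \<and> x \<notin> \<xi> \<and> neighbours L y x")
  case True
  have \<xi>': "\<xi> \<subseteq> {0..<L}" "card \<xi> = N" "finite \<xi>"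
    using \<xi> by (auto simp: configs_def intro: finite_subset)
  have xy: "x \<noteq> y" using True by auto
  have sym: "neighbours L x y" using True by (auto simp: neighbours_def)
  have "hop L N y x * (fermion_sign y \<xi> * fermion_sign x (\<xi> - {y})) = 1"
  proof -
    consider "x = Suc y" | "y = Suc x" | "x \<noteq> Suc y" "y \<noteq> Suc x" "x = 0" "y = L - 1"
      | "x \<noteq> Suc y" "y \<noteq> Suc x" "x = L - 1" "y = 0"
      using sym neighbours_iff[OF assms(2-4)] by blast
    then show ?thesis
    proof cases
      case 1
      then show ?thesis using True by (simp add: hop_def fermion_sign_delete fermion_sign_Suc)
    next
      case 2
      then show ?thesis using True by (simp add: hop_def fermion_sign_delete fermion_sign_Suc)
    next
      case 3
      then show ?thesis
        using True sym \<xi>' fermion_sign_last[OF \<xi>'(1)]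
        by (simp add: hop_def flip: power_mult_distrib)
    next
      case 4
      have "\<xi> - {y} - {L - 1} = \<xi> - {y}" using 4 True by auto
      moreover have "\<xi> - {y} \<subseteq> {0..<L}" using \<xi>' by auto
      ultimately have "fermion_sign x (\<xi> - {y}) = (-1) ^ (N - 1)"
        using 4 True \<xi>' fermion_sign_last[of "\<xi> - {y}" L] by simp
      then show ?thesis
        using 4 sym by (simp add: hop_def flip: power_mult_distrib)
    qed
  qed
  then show ?thesis
    using True xy by (simp add: create_def annihilate_def flip: mult.assoc)
next
  case False
  have "\<not> neighbours L x x" using assms neighbours_iff[of x L x] by auto
  moreover have "neighbours L x y \<longleftrightarrow> neighbours L y x" by (auto simp: neighbours_def)
  moreover have "neighbours L x y" if "x = Suc y \<or> y = Suc x"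
    using that assms neighbours_iff[of x L y] by auto
  ultimately show ?thesis
    using False by (auto simp: hop_def create_def annihilate_def)
qed

text \<open>
  On configurations of \<open>N\<close> particles all signs cancel, so the fermionic hopping operator is the
  adjacency matrix of the exclusion process.
\<close>

lemma second_quantization_hop:
  assumes "2 \<le> L" and \<xi>: "\<xi> \<in> configs L N"
  shows "second_quantization L (hop L N) f \<xi> =
           (\<Sum>\<eta>\<in>configs L N. of_real (adjacency L \<xi> \<eta>) * f \<eta>)"
proof -
  define T where "T = {(y, x). y \<in> \<xi> \<and> x \<in> {0..<L} - \<xi> \<and> neighbours L y x}"
  define g where "g = (\<lambda>(y, x). insert x (\<xi> - {y}))"
  have \<xi>': "\<xi> \<subseteq> {0..<L}" "card \<xi> = N" "finite \<xi>"
    using \<xi> by (auto simp: configs_def intro: finite_subset)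
  have T: "T \<subseteq> {..<L} \<times> {..<L}" using \<xi>' by (auto simp: T_def)
  have "second_quantization L (hop L N) f \<xi> =
          (\<Sum>(y, x)\<in>{..<L} \<times> {..<L}. hop L N y x * create y (annihilate x f) \<xi>)"
    by (simp add: second_quantization_def sum.cartesian_product)
  also have "\<dots> = (\<Sum>p\<in>{..<L} \<times> {..<L}. if p \<in> T then f (g p) else 0)"
    by (intro sum.cong refl)
       (auto simp: hop_create_annihilate[OF \<xi> _ _ assms(1)] T_def g_def split: if_splits)
  also have "\<dots> = (\<Sum>p\<in>T. f (g p))"
    using T by (simp add: sum.If_cases Int_absorb1)
  also have "\<dots> = sum f (g ` T)"
  proof (rule sum.reindex[symmetric, unfolded o_def])
    show "inj_on g T"
    proof (rule inj_onI, clarsimp simp: g_def T_def)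
      fix y x y' x'
      assume *: "insert x (\<xi> - {y}) = insert x' (\<xi> - {y'})" "y \<in> \<xi>" "x \<notin> \<xi>" "y' \<in> \<xi>" "x' \<notin> \<xi>"
      have "x = x'" using * by blast
      moreover have "y \<notin> insert x (\<xi> - {y})" using * by auto
      then have "y \<notin> insert x' (\<xi> - {y'})" using *(1) by simp
      then have "y = y'" using * by auto
      ultimately show "y = y' \<and> x = x'" by simp
    qed
  qed
  also have "g ` T = {\<eta> \<in> configs L N. adjacent L \<xi> \<eta>}"
  proof (rule equalityI; rule subsetI)
    fix \<eta> assume "\<eta> \<in> g ` T"
    then obtain y x where *: "y \<in> \<xi>" "x \<in> {0..<L} - \<xi>" "neighbours L y x" "\<eta> = insert x (\<xi> - {y})"
      by (auto simp: g_def T_def)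
    then have "card \<eta> = N"
      using \<xi>' card_Suc_Diff1[of \<xi> y] by simp
    then show "\<eta> \<in> {\<eta> \<in> configs L N. adjacent L \<xi> \<eta>}"
      using * \<xi>' unfolding configs_def adjacent_def by blast
  next
    fix \<eta> assume "\<eta> \<in> {\<eta> \<in> configs L N. adjacent L \<xi> \<eta>}"
    then obtain y x where "y \<in> \<xi>" "x \<in> {0..<L} - \<xi>" "neighbours L y x" "\<eta> = insert x (\<xi> - {y})"
      by (auto simp: adjacent_def)
    then show "\<eta> \<in> g ` T"
      by (intro image_eqI[of _ _ "(y, x)"]) (auto simp: g_def T_def)
  qed
  also have "sum f \<dots> = (\<Sum>\<eta>\<in>configs L N. of_real (adjacency L \<xi> \<eta>) * f \<eta>)"
    by (auto simp: adjacency_def sum.If_cases Int_def intro!: sum.mono_neutral_cong_left split: if_splits)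
  finally show ?thesis .
qed

section \<open>Plane waves\<close>

text \<open>
  The momenta that are compatible with the factor \<open>(-1) ^ (N - 1)\<close> on the closing bond are
  integral or half-integral multiples of \<open>2 * pi / L\<close>, depending on the parity of \<open>N\<close>. This
  numbering covers both cases and places the modes \<open>0, \<dots>, N - 1\<close> symmetrically around momentum zero.
\<close>

definition momentum :: "nat \<Rightarrow> nat \<Rightarrow> nat \<Rightarrow> real" where
  "momentum L N k = (2 * real k - real N + 1) * pi / real L"

definition mode :: "nat \<Rightarrow> nat \<Rightarrow> nat \<Rightarrow> nat \<Rightarrow> complex" where
  "mode L N k x = cis (momentum L N k * real x)"

text \<open>
  A site has two neighbours, except on the ring with two sites, where it has one.
\<close>

definition hop_multiplicity :: "nat \<Rightarrow> real" where
  "hop_multiplicity L = (if L = 2 then 1 else 2)"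

lemma mode_boundary:
  assumes "0 < L" "1 \<le> N"
  shows "mode L N k L = (-1) ^ (N - 1)"
proof -
  have "momentum L N k * real L = 2 * pi * real k + real (N - 1) * (- pi)"
    using assms by (simp add: momentum_def field_simps)
  moreover have "cis (real (N - 1) * (- pi)) = (-1) ^ (N - 1)"
    unfolding DeMoivre[symmetric] by (simp add: complex_eq_iff flip: cis_inverse)
  ultimately have "mode L N k L = cis (2 * pi * real k) * (-1) ^ (N - 1)"
    unfolding mode_def by (metis cis_mult)
  then show ?thesis by simp
qed

lemma mode_Suc: "mode L N k (Suc x) = cis (momentum L N k) * mode L N k x"
  by (simp add: mode_def cis_mult algebra_simps)

text \<open>
  The two neighbours contribute \<open>cis p + cis (- p) = 2 * cos p\<close> times the value at \<open>y\<close>, where \<open>p\<close> is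
  the momentum. By \<open>mode_boundary\<close> this persists across the closing bond. For \<open>L = 2\<close>
  the momentum is a multiple of \<open>pi\<close>, so that the one neighbour contributes \<open>cis p = cos p\<close>.
\<close>

lemma hop_mode:
  assumes "2 \<le> L" "1 \<le> N" "N \<le> L - 1" "y < L"
  shows "(\<Sum>x<L. hop L N y x * mode L N k x) =
           of_real (hop_multiplicity L * cos (momentum L N k)) * mode L N k y"
proof (cases "L = 2")
  case True
  then have "N = 1" using assms by simp
  have "{..<L} = {0, 1}" using True by auto
  moreover have "momentum L N k = real k * pi"
    using True \<open>N = 1\<close> by (simp add: momentum_def)
  then have "cis (momentum L N k) = of_real (cos (momentum L N k))"
    by (simp add: complex_eq_iff)
  moreover have "mode L N k 0 = 1" "mode L N k (Suc 0) = cis (momentum L N k)"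
    by (simp_all add: mode_def)
  moreover have "cos (momentum L N k) * cos (momentum L N k) = 1"
    using \<open>momentum L N k = _\<close> by (simp flip: power_mult_distrib)
  then have "complex_of_real (cos (momentum L N k)) * of_real (cos (momentum L N k)) = 1"
    by (metis of_real_1 of_real_mult)
  moreover have "\<not> neighbours L 0 0" "\<not> neighbours L (Suc 0) (Suc 0)"
    using True by (simp_all add: neighbours_def)
  moreover have "y = 0 \<or> y = 1" using True assms by auto
  ultimately show ?thesis
    using True by (auto simp: hop_def hop_multiplicity_def)
next
  case False
  then have L: "3 \<le> L" using assms by simp
  define s :: complex where "s = (-1) ^ (N - 1)"
  define m where "m = mode L N k"
  define w where "w = cis (momentum L N k)"
  define u where "u = cis (- momentum L N k)"
  have s: "s * s = 1" by (simp add: s_def flip: power_mult_distrib)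
  have wu: "u * w = 1" by (simp add: u_def w_def cis_mult)
  have m_Suc: "m (Suc x) = w * m x" for x
    by (simp add: m_def w_def mode_Suc)
  have m_0: "m 0 = 1" by (simp add: m_def mode_def)
  have m_L: "m L = s"
    using assms by (simp add: m_def s_def mode_boundary)
  (* The left neighbour of site 0 is L - 1, so this is the value of the wave at -1. *)
  have m_last: "s * m (L - 1) = u"
  proof -
    have "w * m (L - 1) = s" using m_Suc[of "L - 1"] m_L assms by simp
    then have "s * s = w * (s * m (L - 1))" by (metis mult.left_commute)
    then show ?thesis using s wu by (metis mult.assoc mult.right_neutral mult_1)
  qed
  have "hop L N y x * m x =
          (if x = Suc y then m x else 0) + (if x = y - 1 then (if y = 0 then 0 else m x) else 0)
          + (if x = 0 then (if y = L - 1 then s * m x else 0) else 0)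
          + (if x = L - 1 then (if y = 0 then s * m x else 0) else 0)" if "x < L" for x
  proof -
    have nb: "neighbours L x y \<longleftrightarrow>
        x = Suc y \<or> y = Suc x \<or> (x = 0 \<and> y = L - 1) \<or> (x = L - 1 \<and> y = 0)"
      using that assms by (rule_tac neighbours_iff) auto
    show ?thesis
    proof (cases y)
      case 0
      moreover have "L - Suc 0 \<noteq> 0" "L - Suc 0 \<noteq> Suc 0" using L by auto
      ultimately show ?thesis using nb
        by (cases "x = 0"; cases "x = Suc 0"; cases "x = L - Suc 0") (simp_all add: hop_def s_def)
    next
      case (Suc z)
      consider "x = z" | "x = Suc y" | "x = 0" "y = L - 1" "x \<noteq> z"
        | "x \<noteq> z" "x \<noteq> Suc y" "\<not> (x = 0 \<and> y = L - 1)"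
        by blast
      then show ?thesis
        by cases (use Suc L nb in \<open>auto simp: hop_def s_def\<close>)
    qed
  qed
  then have "(\<Sum>x<L. hop L N y x * m x) =
          (if Suc y < L then m (Suc y) else 0) + (if y = 0 then 0 else m (y - 1))
          + (if y = L - 1 then s * m 0 else 0) + (if y = 0 then s * m (L - 1) else 0)"
    using assms L by (simp add: sum.distrib)
  also have "\<dots> = w * m y + u * m y"
  proof -
    have up: "(if Suc y < L then m (Suc y) else 0) + (if y = L - 1 then s * m 0 else 0) = w * m y"
      using assms m_L m_0 m_Suc[of y] by (cases "Suc y = L") auto
    have down: "(if y = 0 then 0 else m (y - 1)) + (if y = 0 then s * m (L - 1) else 0) = u * m y"
    proof (cases y)
      case 0
      then show ?thesis using m_last m_0 by simp
    next
      case (Suc z)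
      then show ?thesis using m_Suc[of z] wu by (simp flip: mult.assoc)
    qed
    show ?thesis using up down by (simp add: algebra_simps)
  qed
  also have "\<dots> = of_real (2 * cos (momentum L N k)) * m y"
    by (simp add: w_def u_def complex_eq_iff flip: distrib_right)
  finally show ?thesis
    using False by (simp add: m_def hop_multiplicity_def)
qed

lemma orthogonal_modes_mode:
  assumes "0 < L"
  shows "orthogonal_modes L (mode L N) {0..<L} (of_nat L)"
proof
  fix k l assume kl: "k \<in> {0..<L}" "l \<in> {0..<L}"
  (* The common phase cis ((1 - N) * pi * x / L) of the two modes cancels, which leaves a geometric
     sum over a quotient of two L-th roots of unity. *)
  define z where "z j = cis (2 * pi * real j / real L)" for j
  have z_power: "z j ^ L = 1" for j
    using assms by (simp add: z_def DeMoivre)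
  have inj: "inj_on z {..<L}"
    using bij_betw_roots_unity[OF assms] by (simp add: bij_betw_def z_def[abs_def])
  have "cnj (mode L N k x) * mode L N l x = (z l / z k) ^ x" for x
  proof -
    have "real x * (2 * pi * real l / real L - 2 * pi * real k / real L) =
            momentum L N l * real x - momentum L N k * real x"
      using assms by (simp add: momentum_def field_simps)
    then show ?thesis
      by (simp add: mode_def z_def cis_cnj cis_mult cis_divide DeMoivre)
  qed
  then have *: "(\<Sum>x<L. cnj (mode L N k x) * mode L N l x) = (\<Sum>x<L. (z l / z k) ^ x)"
    by simp
  show "(\<Sum>x<L. cnj (mode L N k x) * mode L N l x) = (if k = l then of_nat L else 0)"
  proof (cases "k = l")
    case True
    then show ?thesis using * by (simp add: z_def)
  next
    case False
    then have "z l / z k \<noteq> 1"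
      using inj kl by (auto simp: inj_on_def z_def)
    moreover have "(z l / z k) ^ L = 1"
      by (simp add: power_divide z_power)
    ultimately show ?thesis
      using * False by (simp add: geometric_sum)
  qed
qed (use assms in simp)

section \<open>Diagonalisation of the adjacency matrix\<close>

text \<open>
  The set \<open>K\<close> of occupied modes has \<open>N\<close> elements below \<open>L\<close>; the states are therefore indexed by
  \<open>configs L N\<close> itself, and there are as many of them as configurations.
\<close>

definition fermi_state :: "nat \<Rightarrow> nat \<Rightarrow> nat set \<Rightarrow> nat set \<Rightarrow> complex" where
  "fermi_state L N K = slater L (mode L N) (sorted_list_of_set K)"

definition energy :: "nat \<Rightarrow> nat \<Rightarrow> nat set \<Rightarrow> real" where
  "energy L N K = hop_multiplicity L * (\<Sum>k\<in>K. cos (momentum L N k))"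

lemma configsD:
  assumes "K \<in> configs L N"
  shows "finite K" "K \<subseteq> {0..<L}" "card K = N"
  using assms by (auto simp: configs_def intro: finite_subset)

lemma adjacency_fermi_state:
  assumes "2 \<le> L" "1 \<le> N" "N \<le> L - 1" "K \<in> configs L N" "\<xi> \<in> configs L N"
  shows "(\<Sum>\<eta>\<in>configs L N. of_real (adjacency L \<xi> \<eta>) * fermi_state L N K \<eta>) =
           of_real (energy L N K) * fermi_state L N K \<xi>"
proof -
  let ?e = "\<lambda>k. complex_of_real (hop_multiplicity L * cos (momentum L N k))"
  have "(\<Sum>k\<leftarrow>sorted_list_of_set K. ?e k) = (\<Sum>k\<in>K. ?e k)"
    using configsD[OF assms(4)] by (simp add: sum_list_distinct_conv_sum_set)
  also have "\<dots> = of_real (energy L N K)"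
    by (simp add: energy_def sum_distrib_left)
  finally have "second_quantization L (hop L N) (fermi_state L N K) \<xi> =
                  of_real (energy L N K) * fermi_state L N K \<xi>"
    using second_quantization_slater[of "sorted_list_of_set K" L "hop L N" "mode L N" ?e \<xi>]
      hop_mode[OF assms(1-3)] by (simp add: fermi_state_def)
  then show ?thesis
    using assms by (simp add: second_quantization_hop)
qed

lemma fermi_state_orthogonal:
  assumes "0 < L" and K: "K \<in> configs L N" and K': "K' \<in> configs L N"
  shows "(\<Sum>\<xi>\<in>configs L N. cnj (fermi_state L N K \<xi>) * fermi_state L N K' \<xi>) =
           (if K = K' then of_nat L ^ N else 0)"
proof -
  interpret orthogonal_modes L "mode L N" "{0..<L}" "of_nat L"
    using assms(1) by (rule orthogonal_modes_mode)
  note D = configsD[OF K] configsD[OF K']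
  (* The states vanish off configs L N, so the sum is the inner product over all subsets. *)
  have "fermi_state L N K \<xi> = 0" if "\<xi> \<notin> configs L N" for \<xi>
    using that slater_support[of L "mode L N" "sorted_list_of_set K" \<xi>] D
    by (auto simp: fermi_state_def)
  then have "(\<Sum>\<xi>\<in>configs L N. cnj (fermi_state L N K \<xi>) * fermi_state L N K' \<xi>) =
               inner_prod L (fermi_state L N K) (fermi_state L N K')"
    unfolding inner_prod_def by (intro sum.mono_neutral_left) (auto simp: configs_def)
  also have "\<dots> = (if K = K' then of_nat L ^ N else 0)"
  proof (cases "K = K'")
    case True
    then show ?thesis
      using D inner_prod_slater_self[of "sorted_list_of_set K"] by (simp add: fermi_state_def)
  next
    case False
    then obtain k where "k \<in> K" "k \<notin> K'"
      using D by (metis card_subset_eq subsetI)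
    then show ?thesis
      using False D
        inner_prod_slater_distinct[of "sorted_list_of_set K" "sorted_list_of_set K'" k]
      by (simp add: fermi_state_def)
  qed
  finally show ?thesis .
qed

section \<open>The two highest energy levels\<close>

text \<open>
  Passing from \<open>A\<close> to \<open>B\<close> replaces at least one element, and each replacement loses at least
  \<open>a - b\<close>.
\<close>

lemma sum_exchange_le:
  fixes f :: "'a \<Rightarrow> real"
  assumes "finite A" "finite B" "card A = card B" "A \<noteq> B" "b \<le> a"
    and "\<And>x. x \<in> A \<Longrightarrow> a \<le> f x" "\<And>x. x \<in> B - A \<Longrightarrow> f x \<le> b"
  shows "sum f B \<le> sum f A - (a - b)"
proof -
  have card: "card (A - B) = card (B - A)"
    using assms(1-3) by (metis card_Diff_subset_Int finite_Int inf_commute)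
  have "B - A \<noteq> {}"
    using assms(1-4) by (metis Diff_eq_empty_iff card_subset_eq)
  then have "1 \<le> card (B - A)"
    using assms(2) by (simp add: Suc_le_eq card_gt_0_iff)
  then have "a - b \<le> real (card (B - A)) * (a - b)"
    using assms(5) by (simp add: mult_le_cancel_right1)
  moreover have "real (card (B - A)) * a \<le> sum f (A - B)"
    using sum_bounded_below[of "A - B" a f] assms(6) card by simp
  moreover have "sum f (B - A) \<le> real (card (B - A)) * b"
    using sum_bounded_above[of "B - A" f b] assms(7) by simp
  moreover have "sum f A = sum f (A \<inter> B) + sum f (A - B)"
    using assms(1) by (metis sum.Int_Diff)
  moreover have "sum f B = sum f (A \<inter> B) + sum f (B - A)"
    using assms(2) by (metis sum.Int_Diff inf_commute)
  ultimately show ?thesis by (simp add: algebra_simps)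
qed

lemma cos_momentum_occupied:
  assumes "k < N" "N \<le> L"
  shows "cos ((real N - 1) * (pi / real L)) \<le> cos (momentum L N k)"
proof -
  have "\<bar>2 * real k - real N + 1\<bar> \<le> real N - 1"
    using assms by linarith
  then have "\<bar>2 * real k - real N + 1\<bar> * (pi / real L) \<le> (real N - 1) * (pi / real L)"
    by (rule mult_right_mono) simp
  also have "\<bar>2 * real k - real N + 1\<bar> * (pi / real L) = \<bar>momentum L N k\<bar>"
    by (simp add: momentum_def abs_mult)
  finally have le: "\<bar>momentum L N k\<bar> \<le> (real N - 1) * (pi / real L)" .
  have "(real N - 1) * pi \<le> real L * pi"
    using assms by (intro mult_right_mono) auto
  then have "(real N - 1) * (pi / real L) \<le> pi"
    using assms by (simp add: field_simps)
  then show ?thesis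
    using cos_monotone_0_pi_le[OF _ le] by simp
qed

text \<open>
  The momenta of these modes fill the arc from \<open>(N + 1) * pi / L\<close> to \<open>2 * pi - (N + 1) * pi / L\<close>,
  on which the cosine is largest at the end points.
\<close>

lemma cos_momentum_empty:
  assumes "N \<le> k" "k < L"
  shows "cos (momentum L N k) \<le> cos ((real N + 1) * (pi / real L))"
proof -
  define t where "t = pi / real L"
  have t: "0 \<le> t" "real L * t = pi" using assms by (simp_all add: t_def)
  have m: "momentum L N k = (2 * real k - real N + 1) * t"
    by (simp add: momentum_def t_def)
  have lower: "(real N + 1) * t \<le> momentum L N k"
    unfolding m using assms t by (intro mult_right_mono) auto
  have "(2 * real k - real N + 1) * t \<le> (2 * real L - (real N + 1)) * t"
    using assms t by (intro mult_right_mono) auto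
  then have upper: "(real N + 1) * t \<le> 2 * pi - momentum L N k"
    using t by (simp add: m algebra_simps)
  have nonneg: "0 \<le> (real N + 1) * t" using t by simp
  have "cos (momentum L N k) \<le> cos ((real N + 1) * t)"
  proof (cases "momentum L N k \<le> pi")
    case True
    then show ?thesis using lower nonneg by (intro cos_monotone_0_pi_le)
  next
    case False
    then have "cos (2 * pi - momentum L N k) \<le> cos ((real N + 1) * t)"
      using upper nonneg by (intro cos_monotone_0_pi_le) auto
    then show ?thesis by (simp add: cos_2pi_minus)
  qed
  then show ?thesis by (simp add: t_def)
qed

text \<open>
  The momenta are spaced by \<open>2 * pi / L\<close>, so multiplication by \<open>2 * sin (pi / L)\<close> makes the sum
  telescope.
\<close>

lemma sum_cos_momentum:
  assumes "0 < L"
  shows "sin (pi / real L) * (\<Sum>k = 0..<N. cos (momentum L N k)) = sin (real N * (pi / real L))"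
proof -
  define t where "t = pi / real L"
  define g where "g k = sin ((2 * real k - real N) * t)" for k
  have "2 * (sin t * cos (momentum L N k)) = g (Suc k) - g k" for k
  proof -
    have "momentum L N k + t = (2 * real (Suc k) - real N) * t"
      and "momentum L N k - t = (2 * real k - real N) * t"
      using assms by (simp_all add: momentum_def t_def field_simps)
    then have "g (Suc k) - g k = sin (momentum L N k + t) - sin (momentum L N k - t)"
      by (simp add: g_def)
    then show ?thesis by (simp add: sin_add sin_diff)
  qed
  then have "2 * (sin t * (\<Sum>k = 0..<N. cos (momentum L N k))) = (\<Sum>k = 0..<N. g (Suc k) - g k)"
    by (simp add: sum_distrib_left)
  also have "\<dots> = g N - g 0"
    by (rule sum_Suc_diff') simp
  also have "\<dots> = 2 * sin (real N * t)"
    by (simp add: g_def)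
  finally show ?thesis by (simp add: t_def)
qed

lemma cos_momentum_gap:
  "cos ((real N - 1) * t) - cos ((real N + 1) * t) = 2 * sin (real N * t) * sin t"
  by (simp add: cos_add cos_diff algebra_simps)

locale exclusion_ring =
  fixes L N :: nat
  assumes L: "2 \<le> L" and N: "1 \<le> N" "N \<le> L - 1"
begin

definition t :: real where "t = pi / real L"

text \<open>
  In the ground state the \<open>N\<close> modes of largest cosine are filled; the first excited state promotes the
  mode \<open>N - 1\<close> at the edge to \<open>N\<close>.
\<close>

definition ground :: "nat set" where "ground = {0..<N}"

definition excited :: "nat set" where "excited = insert N {0..<N - 1}"

lemma sin_pos: "0 < sin t" "0 < sin (real N * t)"
proof -
  have t: "0 < t" "real L * t = pi" using L by (simp_all add: t_def)
  have "real N * t < real L * t" "1 * t < real L * t"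
    using L N t by (intro mult_strict_right_mono; simp)+
  then show "0 < sin t" "0 < sin (real N * t)"
    using t N by (auto intro!: sin_gt_zero)
qed

lemma hop_multiplicity_pos: "0 < hop_multiplicity L"
  by (simp add: hop_multiplicity_def)

lemma ground_configs: "ground \<in> configs L N"
  using L N by (auto simp: ground_def configs_def)

lemma excited_configs: "excited \<in> configs L N"
  using L N by (auto simp: excited_def configs_def)

lemma excited_neq_ground: "excited \<noteq> ground"
  by (auto simp: excited_def ground_def)

lemma energy_ground: "energy L N ground = hop_multiplicity L * (sin (real N * t) / sin t)"
  using sum_cos_momentum[of L N, folded t_def] L sin_pos
  by (simp add: energy_def ground_def nonzero_eq_divide_eq mult.commute)

lemma energy_ground_pos: "0 < energy L N ground"
  using sin_pos hop_multiplicity_pos by (simp add: energy_ground)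

lemma energy_excited:
  "energy L N excited = energy L N ground - hop_multiplicity L * (2 * sin (real N * t) * sin t)"
proof -
  have "{0..<N} = insert (N - 1) {0..<N - 1}"
    using N by auto
  then have "(\<Sum>k\<in>ground. cos (momentum L N k)) =
               cos (momentum L N (N - 1)) + (\<Sum>k = 0..<N - 1. cos (momentum L N k))"
    by (simp add: ground_def)
  moreover have "(\<Sum>k\<in>excited. cos (momentum L N k)) =
               cos (momentum L N N) + (\<Sum>k = 0..<N - 1. cos (momentum L N k))"
    by (simp add: excited_def)
  moreover have "momentum L N (N - 1) = (real N - 1) * t" "momentum L N N = (real N + 1) * t"
    using N by (simp_all add: momentum_def t_def of_nat_diff)
  ultimately have "(\<Sum>k\<in>excited. cos (momentum L N k)) =
      (\<Sum>k\<in>ground. cos (momentum L N k)) - 2 * sin (real N * t) * sin t"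
    using cos_momentum_gap[of N t] by simp
  then show ?thesis by (simp add: energy_def right_diff_distrib)
qed

text \<open>
  The quotient of the two levels is free of \<open>N\<close>: the ground energy is proportional to
  \<open>sin (N * t) / sin t\<close> and the energy gap to \<open>2 * sin (N * t) * sin t\<close>, with the same factor, whence
  the relative gap is \<open>2 * (sin t)\<^sup>2\<close>.
\<close>

lemma energy_excited_eq: "energy L N excited = energy L N ground * cos (2 * t)"
proof -
  have "energy L N ground * (1 - cos (2 * t)) = hop_multiplicity L * (2 * sin (real N * t) * sin t)"
    using sin_pos by (simp add: energy_ground cos_double_sin power2_eq_square)
  then show ?thesis by (simp add: energy_excited algebra_simps)
qed

lemma energy_le_excited:
  assumes "K \<in> configs L N" "K \<noteq> ground"
  shows "energy L N K \<le> energy L N excited"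
proof -
  let ?f = "\<lambda>k. cos (momentum L N k)"
  note D = configsD[OF assms(1)]
  have pos: "0 < 2 * sin (real N * t) * sin t" using sin_pos by simp
  have "sum ?f K \<le> sum ?f ground - (cos ((real N - 1) * t) - cos ((real N + 1) * t))"
  proof (rule sum_exchange_le)
    show "cos ((real N + 1) * t) \<le> cos ((real N - 1) * t)"
      using cos_momentum_gap[of N t] pos by linarith
  qed (use D assms L N cos_momentum_occupied cos_momentum_empty in \<open>auto simp: ground_def t_def\<close>)
  then have "sum ?f K \<le> sum ?f ground - 2 * sin (real N * t) * sin t"
    by (simp only: cos_momentum_gap)
  then have "hop_multiplicity L * sum ?f K \<le>
      hop_multiplicity L * (sum ?f ground - 2 * sin (real N * t) * sin t)"
    using hop_multiplicity_pos by (intro mult_left_mono) auto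
  then show ?thesis
    unfolding energy_excited by (simp add: energy_def right_diff_distrib)
qed

lemma energy_le_ground:
  assumes "K \<in> configs L N"
  shows "energy L N K \<le> energy L N ground"
proof (cases "K = ground")
  case False
  have "0 < hop_multiplicity L * (2 * sin (real N * t) * sin t)"
    using sin_pos hop_multiplicity_pos by simp
  then show ?thesis
    using energy_le_excited[OF assms False] energy_excited by linarith
qed simp

end

section \<open>The spectrum of the MESSEP\<close>

text \<open>
  The easy half of the Perron-Frobenius theorem: evaluate the eigenvalue equation for \<open>v\<close> at a
  point where the quotient of \<open>cmod (v x)\<close> by \<open>\<psi> x\<close> is maximal.
\<close>

lemma eigenvalue_le_positive_eigenvalue:
  fixes k :: "'a \<Rightarrow> 'a \<Rightarrow> real" and v :: "'a \<Rightarrow> complex"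
  assumes S: "finite S" and nonneg: "\<And>x y. 0 \<le> k x y"
    and pos: "\<And>x. x \<in> S \<Longrightarrow> 0 < \<psi> x"
    and \<psi>: "\<And>x. x \<in> S \<Longrightarrow> (\<Sum>y\<in>S. k x y * \<psi> y) = r * \<psi> x"
    and v: "\<And>x. x \<in> S \<Longrightarrow> (\<Sum>y\<in>S. of_real (k x y) * v y) = e * v x"
    and a: "a \<in> S" "v a \<noteq> 0"
  shows "cmod e \<le> r"
proof -
  let ?q = "\<lambda>x. cmod (v x) / \<psi> x"
  define M where "M = Max (?q ` S)"
  have "M \<in> ?q ` S" unfolding M_def using S a by (intro Max_in) auto
  then obtain x where x: "x \<in> S" "M = ?q x" by auto
  have le: "cmod (v y) \<le> M * \<psi> y" if "y \<in> S" for y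
  proof -
    have "?q y \<le> M" unfolding M_def using S that by (intro Max_ge) auto
    then show ?thesis using pos[OF that] by (simp add: divide_le_eq)
  qed
  have "0 < M * \<psi> a" using le[OF a(1)] a(2) by (simp add: less_le_trans[of 0 "cmod (v a)"])
  then have "0 < M" using pos[OF a(1)] by (simp add: zero_less_mult_iff)
  have "cmod e * (M * \<psi> x) = cmod (\<Sum>y\<in>S. of_real (k x y) * v y)"
    using x pos[OF x(1)] by (simp add: v norm_mult)
  also have "\<dots> \<le> (\<Sum>y\<in>S. cmod (of_real (k x y) * v y))"
    by (rule norm_sum)
  also have "\<dots> \<le> (\<Sum>y\<in>S. M * (k x y * \<psi> y))"
  proof (rule sum_mono)
    fix y assume "y \<in> S"
    then show "cmod (of_real (k x y) * v y) \<le> M * (k x y * \<psi> y)"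
      using mult_left_mono[OF le nonneg[of x y]] nonneg[of x y] by (simp add: norm_mult mult_ac)
  qed
  also have "\<dots> = r * (M * \<psi> x)"
    using \<psi>[OF x(1)] by (simp add: mult_ac flip: sum_distrib_left)
  finally show ?thesis
    using \<open>0 < M\<close> pos[OF x(1)] by (simp add: mult_le_cancel_right)
qed

context exclusion_ring
begin

context
  fixes \<psi> :: "nat set \<Rightarrow> real"
  assumes \<psi>: "positive_eigenvector L N \<psi>"
begin

lemma \<psi>_pos: "\<xi> \<in> configs L N \<Longrightarrow> 0 < \<psi> \<xi>"
  and \<psi>_eigen: "\<xi> \<in> configs L N \<Longrightarrow>
    (\<Sum>\<eta>\<in>configs L N. adjacency L \<xi> \<eta> * \<psi> \<eta>) = rho L N * \<psi> \<xi>"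
  using \<psi> by (auto simp: positive_eigenvector_def)

lemma energy_ground_le_rho: "energy L N ground \<le> rho L N"
proof -
  obtain \<xi> where "\<xi> \<in> configs L N" "fermi_state L N ground \<xi> \<noteq> 0"
  proof (rule ccontr)
    assume "\<not> thesis"
    then have "\<forall>\<xi>\<in>configs L N. fermi_state L N ground \<xi> = 0" using that by blast
    then have "(\<Sum>\<xi>\<in>configs L N. cnj (fermi_state L N ground \<xi>) * fermi_state L N ground \<xi>) = 0"
      by simp
    then show False
      using fermi_state_orthogonal[OF _ ground_configs ground_configs] L by simp
  qed
  then have "cmod (of_real (energy L N ground)) \<le> rho L N"
    by (intro eigenvalue_le_positive_eigenvalue[of "configs L N" "adjacency L" \<psi> "rho L N"
          "fermi_state L N ground"])
       (auto simp: adjacency_def \<psi>_pos \<psi>_eigen[unfolded adjacency_def]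
          adjacency_fermi_state[OF L N ground_configs, unfolded adjacency_def])
  then show ?thesis by simp
qed

lemma rho_pos: "0 < rho L N"
  using energy_ground_le_rho energy_ground_pos by linarith

text \<open>
  The kernel is \<open>adjacency / rho\<close> conjugated by the diagonal matrix of \<open>\<psi>\<close>. Hence its right
  eigenfunctions are the states divided by \<open>\<psi>\<close>, and the dual family is multiplied by \<open>\<psi>\<close>.
\<close>

lemma proots_messep:
  "proots (char_poly (kernel_matrix (configs L N) (messep_kernel L N \<psi>))) =
     image_mset (\<lambda>K. energy L N K / rho L N) (mset_set (configs L N))"
proof (rule proots_kernel_matrix)
  let ?v = "\<lambda>K \<xi>. fermi_state L N K \<xi> / of_real (\<psi> \<xi>)"
  fix K \<xi> assume K: "K \<in> configs L N" and \<xi>: "\<xi> \<in> configs L N"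
  have "(\<Sum>\<eta>\<in>configs L N. of_real (messep_kernel L N \<psi> \<xi> \<eta>) * ?v K \<eta>) =
          (\<Sum>\<eta>\<in>configs L N. of_real (adjacency L \<xi> \<eta>) * fermi_state L N K \<eta>) /
            of_real (rho L N * \<psi> \<xi>)"
    unfolding sum_divide_distrib
  proof (rule sum.cong[OF refl])
    fix \<eta> assume "\<eta> \<in> configs L N"
    then have "\<psi> \<eta> \<noteq> 0" using \<psi>_pos by force
    then show "of_real (messep_kernel L N \<psi> \<xi> \<eta>) * ?v K \<eta> =
        of_real (adjacency L \<xi> \<eta>) * fermi_state L N K \<eta> / of_real (rho L N * \<psi> \<xi>)"
      by (simp add: messep_kernel_def)
  qed
  also have "\<dots> = of_real (energy L N K / rho L N) * ?v K \<xi>"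
    by (simp add: adjacency_fermi_state[OF L N K \<xi>])
  finally show "(\<Sum>\<eta>\<in>configs L N. of_real (messep_kernel L N \<psi> \<xi> \<eta>) * ?v K \<eta>) =
      of_real (energy L N K / rho L N) * ?v K \<xi>" .
next
  let ?v = "\<lambda>K \<xi>. fermi_state L N K \<xi> / of_real (\<psi> \<xi>)"
  let ?w = "\<lambda>K \<xi>. cnj (fermi_state L N K \<xi>) * of_real (\<psi> \<xi>) / of_nat L ^ N"
  fix K K' assume K: "K \<in> configs L N" and K': "K' \<in> configs L N"
  have "(\<Sum>\<xi>\<in>configs L N. ?w K \<xi> * ?v K' \<xi>) =
          (\<Sum>\<xi>\<in>configs L N. cnj (fermi_state L N K \<xi>) * fermi_state L N K' \<xi>) / of_nat L ^ N"
    unfolding sum_divide_distrib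
  proof (rule sum.cong[OF refl])
    fix \<xi> assume "\<xi> \<in> configs L N"
    then have "\<psi> \<xi> \<noteq> 0" using \<psi>_pos by force
    then show "?w K \<xi> * ?v K' \<xi> =
        cnj (fermi_state L N K \<xi>) * fermi_state L N K' \<xi> / of_nat L ^ N"
      by simp
  qed
  also have "\<dots> = (if K = K' then 1 else 0)"
    using L by (simp add: fermi_state_orthogonal[OF _ K K'])
  finally show "(\<Sum>\<xi>\<in>configs L N. ?w K \<xi> * ?v K' \<xi>) = (if K = K' then 1 else 0)" .
qed simp_all

text \<open>
  The rows of the kernel sum to one, so \<open>1\<close> is an eigenvalue and \<open>rho\<close> is one of the energies. No
  energy exceeds the ground energy, which in turn is at most \<open>rho\<close>.
\<close>

lemma rho_eq: "rho L N = energy L N ground"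
proof -
  have "1 \<in># proots (char_poly (kernel_matrix (configs L N) (messep_kernel L N \<psi>)))"
  proof (rule eigenvalue_mem_proots_kernel_matrix[OF finite_configs ground_configs])
    fix \<xi> assume \<xi>: "\<xi> \<in> configs L N"
    have "(\<Sum>\<eta>\<in>configs L N. messep_kernel L N \<psi> \<xi> \<eta>) =
            (\<Sum>\<eta>\<in>configs L N. adjacency L \<xi> \<eta> * \<psi> \<eta>) / (rho L N * \<psi> \<xi>)"
      by (simp add: messep_kernel_def sum_divide_distrib)
    also have "\<dots> = 1"
      using \<psi>_eigen[OF \<xi>] \<psi>_pos[OF \<xi>] rho_pos by simp
    finally show "(\<Sum>\<eta>\<in>configs L N. messep_kernel L N \<psi> \<xi> \<eta> * (\<lambda>_. 1) \<eta>) = 1 * (\<lambda>_. 1) \<xi>"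
      by simp
  qed simp
  then obtain K where K: "K \<in> configs L N" "energy L N K / rho L N = 1"
    by (auto simp: proots_messep)
  then have "energy L N K = rho L N" using rho_pos by simp
  then show ?thesis
    using energy_le_ground[OF K(1)] energy_ground_le_rho by linarith
qed

theorem second_eigenvalue_eq: "second_eigenvalue L N \<psi> = cos (2 * pi / real L)"
proof -
  let ?e = "\<lambda>K. energy L N K / energy L N ground"
  define R where "R = configs L N - {ground, excited}"
  have R: "configs L N = insert ground (insert excited R)" "ground \<notin> insert excited R" "excited \<notin> R"
    "finite R"
    using ground_configs excited_configs excited_neq_ground by (auto simp: R_def)
  have "ordered_eigenvalues (kernel_matrix (configs L N) (messep_kernel L N \<psi>)) =
          rev (sorted_list_of_multiset
            (add_mset (?e ground) (add_mset (?e excited) (image_mset ?e (mset_set R)))))"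
  proof -
    have "mset_set (configs L N) = add_mset ground (add_mset excited (mset_set R))"
      using R by simp
    then show ?thesis
      unfolding ordered_eigenvalues_def proots_messep rho_eq by simp
  qed
  moreover have "?e excited \<le> ?e ground"
    using energy_ground_pos energy_le_ground[OF excited_configs] by (intro divide_right_mono) auto
  moreover have "x \<le> ?e excited" if x: "x \<in># image_mset ?e (mset_set R)" for x
  proof -
    obtain K where "K \<in> R" "x = ?e K" using \<open>finite R\<close> x by auto
    then show ?thesis
      using energy_ground_pos energy_le_excited[of K]
      by (auto simp: R_def intro!: divide_right_mono)
  qed
  ultimately have "second_eigenvalue L N \<psi> = ?e excited"
    unfolding second_eigenvalue_def by (simp only: second_largest_of_multiset)
  also have "\<dots> = cos (2 * pi / real L)"
    using energy_ground_pos by (simp add: energy_excited_eq t_def)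
  finally show ?thesis .
qed

end

end

section \<open>Asymptotics of the gap\<close>

lemma one_minus_cos_double_bound:
  fixes t :: real
  shows "\<bar>1 - cos (2 * t) - 2 * t\<^sup>2\<bar> \<le> t ^ 4"
proof -
  obtain s where "cos (2 * t) =
      (\<Sum>m<4. cos_coeff m * (2 * t) ^ m) + cos (s + 1 / 2 * real 4 * pi) / fact 4 * (2 * t) ^ 4"
    using Maclaurin_cos_expansion[of "2 * t" 4] by blast
  moreover have "(\<Sum>m<4. cos_coeff m * (2 * t) ^ m) = 1 - 2 * t\<^sup>2"
    by (simp add: lessThan_nat_numeral cos_coeff_def power2_eq_square)
  moreover have "fact 4 = (24 :: real)"
    by (simp add: fact_numeral)
  ultimately have eq: "1 - cos (2 * t) - 2 * t\<^sup>2 = - (2 / 3) * cos (s + 1 / 2 * real 4 * pi) * t ^ 4"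
    by (simp add: power_mult_distrib)
  have "2 * \<bar>cos s\<bar> \<le> 3"
    using abs_cos_le_one[of s] by linarith
  then have "\<bar>- (2 / 3) * cos (s + 1 / 2 * real 4 * pi) * t ^ 4\<bar> \<le> 1 * t ^ 4"
    unfolding abs_mult power_even_abs_numeral[OF even_numeral]
    by (intro mult_mono) auto
  then show ?thesis using eq by simp
qed

lemma gap_bound:
  assumes "2 \<le> L" "1 \<le> N" "N \<le> L - 1" "positive_eigenvector L N \<psi>"
  shows "\<bar>1 - second_eigenvalue L N \<psi> - 2 * pi\<^sup>2 / (real L)\<^sup>2\<bar> \<le> pi ^ 4 / real L ^ 4"
proof -
  interpret exclusion_ring L N using assms by unfold_locales
  show ?thesis
    using one_minus_cos_double_bound[of "pi / real L"] second_eigenvalue_eq[OF assms(4)]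
    by (simp add: power_divide)
qed

theorem proposition2p3:
  shows
    "(\<exists>C > 0. \<forall>N :: nat \<Rightarrow> nat.
        (\<forall>L \<ge> 2. 1 \<le> N L \<and> N L \<le> L - 1) \<longrightarrow>
        (\<lambda>L. real (N L) / real L) \<longlonglongrightarrow> 0 \<longrightarrow>
        (\<forall>L \<ge> 2. \<forall>\<psi>. positive_eigenvector L (N L) \<psi> \<longrightarrow>
           \<bar>1 - second_eigenvalue L (N L) \<psi> - 2 * pi\<^sup>2 / (real L)\<^sup>2\<bar>
             \<le> C * (real (N L) / real L)\<^sup>2 * (1 / (real L)\<^sup>2)))
     \<and>
     (\<forall>K :: real set. compact K \<and> K \<subseteq> {0<..<1} \<longrightarrow>
       (\<exists>C > 0. \<forall>\<alpha> \<in> K. \<forall>N :: nat \<Rightarrow> nat.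
          (\<forall>L \<ge> 2. 1 \<le> N L \<and> N L \<le> L - 1) \<longrightarrow>
          (\<lambda>L. real (N L) / real L) \<longlonglongrightarrow> \<alpha> \<longrightarrow>
          (\<forall>L \<ge> 2. \<forall>\<psi>. positive_eigenvector L (N L) \<psi> \<longrightarrow>
             \<bar>1 - second_eigenvalue L (N L) \<psi> - 2 * pi\<^sup>2 / (real L)\<^sup>2\<bar>
               \<le> C / (real L) ^ 3)))"
proof (intro conjI allI impI exI[of _ "pi ^ 4"] ballI)
  fix N :: "nat \<Rightarrow> nat" and L :: nat and \<psi>
  assume N: "\<forall>L\<ge>2. 1 \<le> N L \<and> N L \<le> L - 1" and L: "2 \<le> L" and \<psi>: "positive_eigenvector L (N L) \<psi>"
  have "1 \<le> (real (N L))\<^sup>2" using N L by (simp add: one_le_power)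
  then have "pi ^ 4 / real L ^ 4 * 1 \<le> pi ^ 4 / real L ^ 4 * (real (N L))\<^sup>2"
    by (intro mult_left_mono) auto
  also have "\<dots> = pi ^ 4 * (real (N L) / real L)\<^sup>2 * (1 / (real L)\<^sup>2)"
    by (simp add: power_divide flip: power_add)
  finally show "\<bar>1 - second_eigenvalue L (N L) \<psi> - 2 * pi\<^sup>2 / (real L)\<^sup>2\<bar>
      \<le> pi ^ 4 * (real (N L) / real L)\<^sup>2 * (1 / (real L)\<^sup>2)"
    using gap_bound[of L "N L" \<psi>] N L \<psi> by fastforce
next
  fix K :: "real set" and \<alpha> :: real and N :: "nat \<Rightarrow> nat" and L :: nat and \<psi>
  assume N: "\<forall>L\<ge>2. 1 \<le> N L \<and> N L \<le> L - 1" and L: "2 \<le> L" and \<psi>: "positive_eigenvector L (N L) \<psi>"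
  have "pi ^ 4 / real L ^ 4 \<le> pi ^ 4 / real L ^ 3"
    using L by (intro divide_left_mono power_increasing) auto
  then show "\<bar>1 - second_eigenvalue L (N L) \<psi> - 2 * pi\<^sup>2 / (real L)\<^sup>2\<bar> \<le> pi ^ 4 / real L ^ 3"
    using gap_bound[of L "N L" \<psi>] N L \<psi> by fastforce
qed simp_all

end
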